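(* Let $V=\mathbb{R}^M$. For every $u\in V$ let $A(u)$ be a symmetric linear operator on $V$ (an $M\times M$ matrix), and suppose there are constants $\kappa_0>0$, $A^{max}\ge 0$, $L_A\ge 0$ such that for all $u,v,\xi,\zeta\in V$ $$\langle A(u)\xi,\xi\rangle\ge \kappa_0\|\xi\|^2,\qquad \langle A(u)\xi,\zeta\rangle\le A^{max}\|\xi\|\,\|\zeta\|,\qquad \|(A(u)-A(v))\xi\|\le L_A\|u-v\|\,\|\xi\|.$$ Let $g\in V$. Then, if $\tau>0$ is small enough (i.e. there is $\tau_0>0$, which may depend on $g$ and on the constants above, such that the following holds for all $0<\tau<\tau_0$), there exists a unique solution $U\in V$ to $$U+\tau A(U)U=g,$$ and it satisfies the bound $$\|U\|\le \frac{1}{1+\tau\kappa_0}\|g\|.$$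
   Context: $\langle\cdot,\cdot\rangle$ and $\|\cdot\|$ denote the Euclidean inner product and norm on $\mathbb{R}^M$. *)

theory Defs
  imports "HOL-Analysis.Analysis"
begin

end

theory Submission
  imports Defs
begin

text \<open>
  Testing the equation with a solution \<open>U\<close> and using coercivity gives
  \<open>(1 + \<tau> \<kappa>) \<parallel>U\<parallel>\<^sup>2 \<le> g \<bullet> U \<le> \<parallel>g\<parallel> \<parallel>U\<parallel>\<close>. This is the required bound, and it places every solution in
  the ball of radius \<open>R = \<parallel>g\<parallel> + 1\<close>, whatever \<open>\<tau>\<close> is.

  Solutions are the fixed points of \<open>u \<mapsto> g - \<tau> A(u)u\<close>. The map \<open>u \<mapsto> A(u)u\<close> is in general only locally
  Lipschitz,
  with constant \<open>A\<^sup>m\<^sup>a\<^sup>x + L R\<close> on that ball. So for small \<open>\<tau>\<close> the fixed-point map is a contraction of the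
  ball into itself, and Banach's theorem yields exactly one solution in the ball. By the bound there is
  none outside.
\<close>

lemma coercive_solution_bound:
  fixes B :: "real ^ 'm ^ 'm"
  assumes "0 \<le> \<kappa>" "0 \<le> \<tau>" and coercive: "\<kappa> * (norm U)\<^sup>2 \<le> (B *v U) \<bullet> U"
    and eq: "U + \<tau> *\<^sub>R (B *v U) = g"
  shows "norm U \<le> 1 / (1 + \<tau> * \<kappa>) * norm g"
proof -
  have pos: "0 < 1 + \<tau> * \<kappa>"
    using assms(1,2) by (simp add: add_pos_nonneg)
  have "(1 + \<tau> * \<kappa>) * (norm U)\<^sup>2 \<le> U \<bullet> U + \<tau> * ((B *v U) \<bullet> U)"
    using mult_left_mono[OF coercive \<open>0 \<le> \<tau>\<close>] by (simp add: power2_norm_eq_inner algebra_simps)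
  also have "\<dots> = g \<bullet> U"
    by (simp add: eq[symmetric] inner_add_left)
  also have "\<dots> \<le> norm g * norm U"
    by (rule norm_cauchy_schwarz)
  finally have "((1 + \<tau> * \<kappa>) * norm U) * norm U \<le> norm g * norm U"
    by (simp add: power2_eq_square mult.assoc)
  then have "(1 + \<tau> * \<kappa>) * norm U \<le> norm g"
    by (cases "U = 0") auto
  with pos show ?thesis
    by (simp add: field_simps)
qed

lemma norm_matrix_vector_mult_le_of_inner_bound:
  fixes B :: "real ^ 'm ^ 'm"
  assumes "\<And>\<zeta>. (B *v \<xi>) \<bullet> \<zeta> \<le> a * norm \<xi> * norm \<zeta>" "0 \<le> a"
  shows "norm (B *v \<xi>) \<le> a * norm \<xi>"
proof (cases "B *v \<xi> = 0")
  case False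
  have "norm (B *v \<xi>) * norm (B *v \<xi>) \<le> (a * norm \<xi>) * norm (B *v \<xi>)"
    using assms(1)[of "B *v \<xi>"] by (simp add: power2_norm_eq_inner[symmetric] power2_eq_square)
  with False show ?thesis
    by simp
qed (simp add: assms(2))

text \<open>
  Split \<open>A(u)u - A(v)v = A(u)(u - v) + (A(u) - A(v))v\<close>. The second term is controlled by \<open>\<parallel>v\<parallel>\<close>, which
  is why a bound on \<open>v\<close> has to enter the constant.
\<close>

lemma quasilinear_lipschitz_on_ball:
  fixes A :: "real ^ 'm \<Rightarrow> real ^ 'm ^ 'm"
  assumes bounded: "\<And>\<xi>. norm (A u *v \<xi>) \<le> a * norm \<xi>"
    and lipschitz: "\<And>\<xi>. norm ((A u - A v) *v \<xi>) \<le> L * norm (u - v) * norm \<xi>"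
    and "0 \<le> L" "norm v \<le> R"
  shows "norm (A u *v u - A v *v v) \<le> (a + L * R) * norm (u - v)"
proof -
  have "A u *v u - A v *v v = A u *v (u - v) + (A u - A v) *v v"
    by (simp add: matrix_vector_mult_diff_distrib matrix_vector_mult_diff_rdistrib)
  then have "norm (A u *v u - A v *v v) \<le> norm (A u *v (u - v)) + norm ((A u - A v) *v v)"
    by (metis norm_triangle_ineq)
  also have "\<dots> \<le> a * norm (u - v) + L * norm (u - v) * norm v"
    by (intro add_mono bounded lipschitz)
  also have "\<dots> \<le> a * norm (u - v) + L * norm (u - v) * R"
    using assms(3,4) by (intro add_left_mono mult_left_mono) auto
  finally show ?thesis
    by (simp add: algebra_simps)
qed

theorem theorem5:
  fixes g :: "real ^ 'm" and \<kappa>0 Amax L\<^sub>A :: real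
  assumes "\<kappa>0 > 0" and "Amax \<ge> 0" and "L\<^sub>A \<ge> 0"
  shows "\<exists>\<tau>0>0. \<forall>A :: real ^ 'm \<Rightarrow> real ^ 'm ^ 'm.
    (\<forall>u. transpose (A u) = A u) \<longrightarrow>
    (\<forall>u \<xi>. (A u *v \<xi>) \<bullet> \<xi> \<ge> \<kappa>0 * (norm \<xi>)\<^sup>2) \<longrightarrow>
    (\<forall>u \<xi> \<zeta>. (A u *v \<xi>) \<bullet> \<zeta> \<le> Amax * norm \<xi> * norm \<zeta>) \<longrightarrow>
    (\<forall>u v \<xi>. norm ((A u - A v) *v \<xi>) \<le> L\<^sub>A * norm (u - v) * norm \<xi>) \<longrightarrow>
    (\<forall>\<tau>. 0 < \<tau> \<and> \<tau> < \<tau>0 \<longrightarrow>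
      (\<exists>!U. U + \<tau> *\<^sub>R (A U *v U) = g) \<and>
      (\<forall>U. U + \<tau> *\<^sub>R (A U *v U) = g \<longrightarrow> norm U \<le> 1 / (1 + \<tau> * \<kappa>0) * norm g))"
proof -
  define R where "R = norm g + 1"
  define K where "K = Amax + L\<^sub>A * R"
  \<comment> \<open>Since \<open>R \<ge> 1\<close> and \<open>A\<^sup>m\<^sup>a\<^sup>x \<le> K\<close>, this single choice gives both the contraction factor
    \<open>\<tau> K < 1\<close> and \<open>\<tau> A\<^sup>m\<^sup>a\<^sup>x R \<le> 1 = R - \<parallel>g\<parallel>\<close>, which keeps the ball invariant.\<close>
  define \<tau>0 where "\<tau>0 = 1 / (R * (K + 1))"
  have R: "1 \<le> R" and K: "Amax \<le> K"
    using assms by (auto simp: R_def K_def)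
  then have "0 \<le> K"
    using assms by simp
  with R have pos: "0 < R * (K + 1)"
    by simp
  have main: "(\<exists>!U. U + \<tau> *\<^sub>R (A U *v U) = g) \<and>
      (\<forall>U. U + \<tau> *\<^sub>R (A U *v U) = g \<longrightarrow> norm U \<le> 1 / (1 + \<tau> * \<kappa>0) * norm g)"
    if coercive: "\<And>u \<xi>. (A u *v \<xi>) \<bullet> \<xi> \<ge> \<kappa>0 * (norm \<xi>)\<^sup>2"
      and bounded: "\<And>u \<xi> \<zeta>. (A u *v \<xi>) \<bullet> \<zeta> \<le> Amax * norm \<xi> * norm \<zeta>"
      and lipschitz: "\<And>u v \<xi>. norm ((A u - A v) *v \<xi>) \<le> L\<^sub>A * norm (u - v) * norm \<xi>"
      and \<tau>: "0 < \<tau>" "\<tau> < \<tau>0"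
    for A :: "real ^ 'm \<Rightarrow> real ^ 'm ^ 'm" and \<tau>
  proof -
    define T where "T u = g - \<tau> *\<^sub>R (A u *v u)" for u
    have T_fix: "T u = u \<longleftrightarrow> u + \<tau> *\<^sub>R (A u *v u) = g" for u
      by (auto simp: T_def algebra_simps)
    have norm_A: "norm (A u *v \<xi>) \<le> Amax * norm \<xi>" for u \<xi>
      by (rule norm_matrix_vector_mult_le_of_inner_bound[OF bounded \<open>Amax \<ge> 0\<close>])
    have "\<tau> * (R * (K + 1)) < 1"
      using \<tau>(2) pos by (simp add: \<tau>0_def pos_less_divide_eq)
    moreover have "\<tau> * K \<le> \<tau> * (R * (K + 1))"
      using R \<open>0 \<le> K\<close> \<tau>(1) mult_mono[of 1 R K "K + 1"] by (intro mult_left_mono) auto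
    moreover have "\<tau> * (Amax * R) \<le> \<tau> * (R * (K + 1))"
      using R K \<tau>(1) mult_right_mono[of Amax "K + 1" R] by (intro mult_left_mono) (auto simp: mult.commute)
    ultimately have small: "\<tau> * K < 1" "\<tau> * (Amax * R) \<le> 1"
      by auto
    have bound: "norm U \<le> 1 / (1 + \<tau> * \<kappa>0) * norm g" if "U + \<tau> *\<^sub>R (A U *v U) = g" for U
      using coercive_solution_bound[OF _ _ coercive that] assms(1) \<tau>(1) by simp
    have solution_in_ball: "U \<in> cball 0 R" if "U + \<tau> *\<^sub>R (A U *v U) = g" for U
    proof -
      have "1 / (1 + \<tau> * \<kappa>0) * norm g \<le> 1 * norm g"
        using assms(1) \<tau>(1) by (intro mult_right_mono) (auto simp: divide_le_eq_1 add_pos_pos)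
      with bound[OF that] show ?thesis
        by (simp add: R_def)
    qed
    have "\<exists>!u\<in>cball 0 R. T u = u"
    proof (rule Banach_fix)
      show "complete (cball (0 :: real ^ 'm) R)"
        by (simp add: complete_eq_closed)
      show "cball (0 :: real ^ 'm) R \<noteq> {}"
        using R by simp
      show "0 \<le> \<tau> * K"
        using \<tau>(1) \<open>0 \<le> K\<close> by simp
      show "\<tau> * K < 1"
        by (rule small)
      show "T ` cball 0 R \<subseteq> cball 0 R"
      proof (intro image_subsetI)
        fix u :: "real ^ 'm" assume "u \<in> cball 0 R"
        then have "Amax * norm u \<le> Amax * R"
          using assms(2) by (intro mult_left_mono) auto
        then have "\<tau> * norm (A u *v u) \<le> \<tau> * (Amax * R)"
          using norm_A[of u u] \<tau>(1) by (intro mult_left_mono) auto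
        moreover have "norm (T u) \<le> norm g + \<tau> * norm (A u *v u)"
          using norm_triangle_ineq4[of g "\<tau> *\<^sub>R (A u *v u)"] \<tau>(1) by (simp add: T_def)
        ultimately show "T u \<in> cball 0 R"
          using small(2) by (simp add: R_def)
      qed
      show "dist (T u) (T v) \<le> \<tau> * K * dist u v" if "u \<in> cball 0 R" "v \<in> cball 0 R" for u v
      proof -
        have "dist (T u) (T v) = norm (\<tau> *\<^sub>R (A v *v v - A u *v u))"
          by (simp add: T_def dist_norm scaleR_diff_right)
        also have "\<dots> = \<tau> * norm (A u *v u - A v *v v)"
          using \<tau>(1) by (simp add: norm_minus_commute)
        also have "\<dots> \<le> \<tau> * (K * norm (u - v))"
          unfolding K_def using that(2) \<tau>(1) assms(3)
          by (intro mult_left_mono quasilinear_lipschitz_on_ball norm_A lipschitz) auto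
        finally show ?thesis
          by (simp add: dist_norm mult.assoc)
      qed
    qed
    then have "\<exists>!U. U + \<tau> *\<^sub>R (A U *v U) = g"
      unfolding T_fix using solution_in_ball by blast
    with bound show ?thesis
      by blast
  qed
  show ?thesis
  proof (intro exI[of _ \<tau>0] conjI allI impI)
    show "0 < \<tau>0"
      using pos by (simp add: \<tau>0_def)
  qed (use main in blast)+
qed

end
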